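(* Let $L$ be a set, let $(X,\alpha)$ be an $L$-labeled metric space and let $((X_n,\alpha_n))_{n\in\mathbb{N}}$ be a sequence of $L$-labeled metric spaces. Then $(X_n,\alpha_n)\to(X,\alpha)$ in the LGH sense if and only if for every $\varepsilon>0$ there exist (1) a finite set $S\subseteq X$ and a labeling $\beta\colon L\to S$ such that $(S,\beta)$ is a labeled $\varepsilon$-net in $(X,\alpha)$, and (2) for each $n\in\mathbb{N}$ a finite set $S_n\subseteq X_n$ and a labeling $\beta_n\colon L\to S_n$ such that $(S_n,\beta_n)$ is a labeled $\varepsilon$-net in $(X_n,\alpha_n)$, so that $(S_n,\beta_n)\to(S,\beta)$ in the LGH sense.
   Context: All metric spaces are assumed to be compact. Given a set $L$, an $L$-labeled metric space is a pair $(X,\alpha)$ where $X$ is a (compact) metric space and $\alpha\colon L\to X$ is an arbitrary map (a labeling). For $L$-labeled metric spaces $(X,\alpha)$, $(Y,\beta)$ and $t\ge 0$, a pseudometric $d\colon (X\sqcup Y)^2\to[0,\infty)$ on the disjoint union is called $(t,L)$-admissible if (1) $d|_{X\times X}=d_X$ and $d|_{Y\times Y}=d_Y$; (2) $d_H(X,Y)\le t$, where $d_H$ is the Hausdorff distance with respect to $d$; (3) $\sup_{\ell\in L}d(\alpha(\ell),\beta(\ell))\le t$ (with $\sup\varnothing=0$). The labeled Gromov-Hausdorff (LGH) distance is $$d_{GH}^L(X,\alpha;Y,\beta):=\inf\{t : \text{there exists a } (t,L)\text{-admissible pseudometric on } X\sqcup Y\}.$$ Convergence $(X_n,\alpha_n)\to(X,\alpha)$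 in the LGH sense means $d_{GH}^L(X_n,\alpha_n;X,\alpha)\to 0$. For $\varepsilon>0$, a subset $S\subseteq X$ is an $\varepsilon$-net in $X$ if for every $x\in X$ there is $s\in S$ with $d_X(s,x)<\varepsilon$. For a finite subset $X_0\subseteq X$ (with the restricted metric) and a labeling $\alpha_0\colon L\to X_0$, $(X_0,\alpha_0)$ is a labeled $\varepsilon$-net in $(X,\alpha)$ if $X_0$ is an $\varepsilon$-net in $X$ and $\sup_{\ell\in L}d_X(\alpha(\ell),\alpha_0(\ell))<\varepsilon$. *)

theory Defs
  imports "HOL-Analysis.Analysis"
begin

(* Suprema and infima are taken in ennreal, so that SUP over the empty set is 0 and INF over the
   empty set is \<infinity>.  The empty metric space is allowed; it is at distance \<infinity> from every nonempty one. *)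

definition labeled_metric_space :: "'l set \<Rightarrow> 'a metric \<Rightarrow> ('l \<Rightarrow> 'a) \<Rightarrow> bool" where
  "labeled_metric_space L X \<alpha> \<longleftrightarrow> compact_space (mtopology_of X) \<and> \<alpha> \<in> L \<rightarrow> mspace X"

definition pseudometric_on :: "'a set \<Rightarrow> ('a \<Rightarrow> 'a \<Rightarrow> real) \<Rightarrow> bool" where
  "pseudometric_on M d \<longleftrightarrow>
     (\<forall>x\<in>M. d x x = 0) \<and>
     (\<forall>x\<in>M. \<forall>y\<in>M. 0 \<le> d x y \<and> d x y = d y x) \<and>
     (\<forall>x\<in>M. \<forall>y\<in>M. \<forall>z\<in>M. d x z \<le> d x y + d y z)"

definition hausdorff_distance :: "('a \<Rightarrow> 'a \<Rightarrow> real) \<Rightarrow> 'a set \<Rightarrow> 'a set \<Rightarrow> ennreal" where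
  "hausdorff_distance d A B =
     max (SUP a\<in>A. INF b\<in>B. ennreal (d a b)) (SUP b\<in>B. INF a\<in>A. ennreal (d a b))"

(* The disjoint union of X and Y is mspace X <+> mspace Y, with injections Inl and Inr. *)
definition admissible ::
  "real \<Rightarrow> 'l set \<Rightarrow> 'a metric \<Rightarrow> ('l \<Rightarrow> 'a) \<Rightarrow> 'b metric \<Rightarrow> ('l \<Rightarrow> 'b)
    \<Rightarrow> ('a + 'b \<Rightarrow> 'a + 'b \<Rightarrow> real) \<Rightarrow> bool" where
  "admissible t L X \<alpha> Y \<beta> d \<longleftrightarrow>
     pseudometric_on (mspace X <+> mspace Y) d \<and>
     (\<forall>x\<in>mspace X. \<forall>x'\<in>mspace X. d (Inl x) (Inl x') = mdist X x x') \<and>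
     (\<forall>y\<in>mspace Y. \<forall>y'\<in>mspace Y. d (Inr y) (Inr y') = mdist Y y y') \<and>
     hausdorff_distance d (Inl ` mspace X) (Inr ` mspace Y) \<le> ennreal t \<and>
     (SUP l\<in>L. ennreal (d (Inl (\<alpha> l)) (Inr (\<beta> l)))) \<le> ennreal t"

definition LGH_dist ::
  "'l set \<Rightarrow> 'a metric \<Rightarrow> ('l \<Rightarrow> 'a) \<Rightarrow> 'b metric \<Rightarrow> ('l \<Rightarrow> 'b) \<Rightarrow> ennreal" where
  "LGH_dist L X \<alpha> Y \<beta> = Inf {ennreal t | t. 0 \<le> t \<and> (\<exists>d. admissible t L X \<alpha> Y \<beta> d)}"

definition LGH_converges ::
  "'l set \<Rightarrow> (nat \<Rightarrow> 'a metric) \<Rightarrow> (nat \<Rightarrow> 'l \<Rightarrow> 'a) \<Rightarrow> 'b metric \<Rightarrow> ('l \<Rightarrow> 'b) \<Rightarrow> bool" where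
  "LGH_converges L Xs \<alpha>s X \<alpha> \<longleftrightarrow> (\<lambda>n. LGH_dist L (Xs n) (\<alpha>s n) X \<alpha>) \<longlonglongrightarrow> 0"

definition eps_net :: "real \<Rightarrow> 'a metric \<Rightarrow> 'a set \<Rightarrow> bool" where
  "eps_net \<epsilon> X S \<longleftrightarrow> S \<subseteq> mspace X \<and> (\<forall>x\<in>mspace X. \<exists>s\<in>S. mdist X s x < \<epsilon>)"

definition labeled_eps_net ::
  "real \<Rightarrow> 'l set \<Rightarrow> 'a metric \<Rightarrow> ('l \<Rightarrow> 'a) \<Rightarrow> 'a set \<Rightarrow> ('l \<Rightarrow> 'a) \<Rightarrow> bool" where
  "labeled_eps_net \<epsilon> L X \<alpha> S \<beta> \<longleftrightarrow>
     finite S \<and> \<beta> \<in> L \<rightarrow> S \<and> eps_net \<epsilon> X S \<and>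
     (SUP l\<in>L. ennreal (mdist X (\<alpha> l) (\<beta> l))) < ennreal \<epsilon>"

end

theory Submission
  imports Defs
begin

text \<open>Finite nets are transported along near-optimal couplings. If \<open>X\<^sub>n\<close> is \<open>t\<close>-close
  to \<open>X\<close>, moving a finite net of \<open>X\<close> pointwise by less than \<open>t\<close> gives a finite net of \<open>X\<^sub>n\<close> that is
  \<open>t\<close>-close to the original one; choosing \<open>t = t\<^sub>n\<close> tending to 0 makes these nets converge.
  Conversely, a coupling of two nets extends to a coupling of the ambient spaces by taking
  the cheapest path through the nets, and this loses at most twice the mesh.\<close>

section \<open>Couplings of metric spaces and pointwise closeness\<close>

definition metric_coupling :: "'a metric \<Rightarrow> 'b metric \<Rightarrow> ('a + 'b \<Rightarrow> 'a + 'b \<Rightarrow> real) \<Rightarrow> bool" where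
  "metric_coupling X Y d \<longleftrightarrow>
     pseudometric_on (mspace X <+> mspace Y) d \<and>
     (\<forall>x\<in>mspace X. \<forall>x'\<in>mspace X. d (Inl x) (Inl x') = mdist X x x') \<and>
     (\<forall>y\<in>mspace Y. \<forall>y'\<in>mspace Y. d (Inr y) (Inr y') = mdist Y y y')"

text \<open>Strict pointwise bounds with witnesses stand in for the suprema and infima over
  \<open>ennreal\<close>: they survive restriction to subsets and chain directly through triangle
  inequalities.\<close>

definition LGH_near ::
  "real \<Rightarrow> 'l set \<Rightarrow> 'a metric \<Rightarrow> ('l \<Rightarrow> 'a) \<Rightarrow> 'b metric \<Rightarrow> ('l \<Rightarrow> 'b) \<Rightarrow> bool" where
  "LGH_near e L X \<alpha> Y \<beta> \<longleftrightarrow> (\<exists>d. metric_coupling X Y d \<and>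
     (\<forall>x\<in>mspace X. \<exists>y\<in>mspace Y. d (Inl x) (Inr y) < e) \<and>
     (\<forall>y\<in>mspace Y. \<exists>x\<in>mspace X. d (Inl x) (Inr y) < e) \<and>
     (\<forall>l\<in>L. d (Inl (\<alpha> l)) (Inr (\<beta> l)) < e))"

lemma Inl_Inr_in_Plus_iff [simp]: "Inl x \<in> A <+> B \<longleftrightarrow> x \<in> A" "Inr y \<in> A <+> B \<longleftrightarrow> y \<in> B"
  by auto

lemma pseudometric_onD:
  assumes "pseudometric_on M d"
  shows "x \<in> M \<Longrightarrow> d x x = 0"
    and "x \<in> M \<Longrightarrow> y \<in> M \<Longrightarrow> 0 \<le> d x y"
    and "x \<in> M \<Longrightarrow> y \<in> M \<Longrightarrow> d x y = d y x"
    and "x \<in> M \<Longrightarrow> y \<in> M \<Longrightarrow> z \<in> M \<Longrightarrow> d x z \<le> d x y + d y z"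
  using assms unfolding pseudometric_on_def by blast+

lemma metric_couplingD:
  assumes "metric_coupling X Y d"
  shows "pseudometric_on (mspace X <+> mspace Y) d"
    and "x \<in> mspace X \<Longrightarrow> x' \<in> mspace X \<Longrightarrow> d (Inl x) (Inl x') = mdist X x x'"
    and "y \<in> mspace Y \<Longrightarrow> y' \<in> mspace Y \<Longrightarrow> d (Inr y) (Inr y') = mdist Y y y'"
  using assms unfolding metric_coupling_def by blast+

lemma metric_coupling_submetric:
  assumes "metric_coupling X Y d"
  shows "metric_coupling (submetric X A) (submetric Y B) d"
  using assms unfolding metric_coupling_def pseudometric_on_def
  by (simp add: Ball_def) blast

section \<open>Passing between the LGH distance and pointwise closeness\<close>

lemma ennreal_INF_less_iff:
  "(INF x\<in>A. ennreal (f x)) < ennreal e \<longleftrightarrow> (\<exists>x\<in>A. f x < e)" if "\<And>x. x \<in> A \<Longrightarrow> 0 \<le> f x"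
  using that by (auto simp: INF_less_iff ennreal_less_iff)

text \<open>An infimum below \<open>e\<close> leaves some admissible \<open>t < e\<close>. This gap
  keeps the suprema strictly below \<open>e\<close>, so each inner infimum has an actual
  witness.\<close>

lemma LGH_near_if_LGH_dist_less:
  assumes "LGH_dist L X \<alpha> Y \<beta> < ennreal e" "\<alpha> \<in> L \<rightarrow> mspace X" "\<beta> \<in> L \<rightarrow> mspace Y"
  shows "LGH_near e L X \<alpha> Y \<beta>"
proof -
  obtain t d where t: "0 \<le> t" "ennreal t < ennreal e" and d: "admissible t L X \<alpha> Y \<beta> d"
    using assms(1) unfolding LGH_dist_def Inf_less_iff by blast
  have c: "metric_coupling X Y d"
    using d unfolding admissible_def metric_coupling_def by blast
  note nn = pseudometric_onD(2)[OF metric_couplingD(1)[OF c]]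
  have h: "(SUP a\<in>mspace X. INF b\<in>mspace Y. ennreal (d (Inl a) (Inr b))) < ennreal e"
    "(SUP b\<in>mspace Y. INF a\<in>mspace X. ennreal (d (Inl a) (Inr b))) < ennreal e"
    "(SUP l\<in>L. ennreal (d (Inl (\<alpha> l)) (Inr (\<beta> l)))) < ennreal e"
    using d t(2) unfolding admissible_def hausdorff_distance_def
    by (auto simp: image_image)
  have "\<exists>y\<in>mspace Y. d (Inl x) (Inr y) < e" if "x \<in> mspace X" for x
    using le_less_trans[OF SUP_upper[OF that] h(1)] that nn
    by (subst (asm) ennreal_INF_less_iff) auto
  moreover have "\<exists>x\<in>mspace X. d (Inl x) (Inr y) < e" if "y \<in> mspace Y" for y
    using le_less_trans[OF SUP_upper[OF that] h(2)] that nn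
    by (subst (asm) ennreal_INF_less_iff) auto
  moreover have "d (Inl (\<alpha> l)) (Inr (\<beta> l)) < e" if "l \<in> L" for l
  proof -
    \<comment> \<open>\<open>ennreal\<close> sends negative reals to 0, so nonnegativity is what
      lets the bound return to the reals; the labels must lie in the spaces for it.\<close>
    have "0 \<le> d (Inl (\<alpha> l)) (Inr (\<beta> l))"
      using that assms(2,3) by (intro nn) auto
    then show ?thesis
      using le_less_trans[OF SUP_upper[OF that] h(3)] by (simp add: ennreal_less_iff)
  qed
  ultimately show ?thesis using c unfolding LGH_near_def by blast
qed

text \<open>Only a weak inequality comes back, since a supremum of values below \<open>e\<close> may
  equal \<open>e\<close>.\<close>

lemma LGH_dist_le_if_LGH_near:
  assumes "LGH_near e L X \<alpha> Y \<beta>" "0 \<le> e"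
  shows "LGH_dist L X \<alpha> Y \<beta> \<le> ennreal e"
proof -
  obtain d where d: "metric_coupling X Y d"
    "\<forall>x\<in>mspace X. \<exists>y\<in>mspace Y. d (Inl x) (Inr y) < e"
    "\<forall>y\<in>mspace Y. \<exists>x\<in>mspace X. d (Inl x) (Inr y) < e"
    "\<forall>l\<in>L. d (Inl (\<alpha> l)) (Inr (\<beta> l)) < e"
    using assms(1) unfolding LGH_near_def by blast
  have "(SUP a\<in>mspace X. INF b\<in>mspace Y. ennreal (d (Inl a) (Inr b))) \<le> ennreal e"
  proof (rule SUP_least)
    fix x
    assume "x \<in> mspace X"
    then obtain y where "y \<in> mspace Y" "d (Inl x) (Inr y) < e" using d(2) by blast
    then show "(INF b\<in>mspace Y. ennreal (d (Inl x) (Inr b))) \<le> ennreal e"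
      by (intro INF_lower2[of y] ennreal_leI) auto
  qed
  moreover have "(SUP b\<in>mspace Y. INF a\<in>mspace X. ennreal (d (Inl a) (Inr b))) \<le> ennreal e"
  proof (rule SUP_least)
    fix y
    assume "y \<in> mspace Y"
    then obtain x where "x \<in> mspace X" "d (Inl x) (Inr y) < e" using d(3) by blast
    then show "(INF a\<in>mspace X. ennreal (d (Inl a) (Inr y))) \<le> ennreal e"
      by (intro INF_lower2[of x] ennreal_leI) auto
  qed
  moreover have "(SUP l\<in>L. ennreal (d (Inl (\<alpha> l)) (Inr (\<beta> l)))) \<le> ennreal e"
    using d(4) by (intro SUP_least ennreal_leI) (auto intro: less_imp_le)
  ultimately have "admissible e L X \<alpha> Y \<beta> d"
    using d(1) unfolding admissible_def metric_coupling_def hausdorff_distance_def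
    by (simp add: image_image)
  then show ?thesis
    using assms(2) unfolding LGH_dist_def by (intro Inf_lower) blast
qed

lemma LGH_near_mono: "LGH_near e L X \<alpha> Y \<beta> \<Longrightarrow> e \<le> e' \<Longrightarrow> LGH_near e' L X \<alpha> Y \<beta>"
  unfolding LGH_near_def
  by (elim ex_forward) (auto intro: less_le_trans, (blast intro: less_le_trans)+)

lemma LGH_converges_imp_near:
  assumes "LGH_converges L Xs \<alpha>s X \<alpha>" "\<And>n. \<alpha>s n \<in> L \<rightarrow> mspace (Xs n)" "\<alpha> \<in> L \<rightarrow> mspace X"
    "0 < e"
  shows "\<forall>\<^sub>F n in sequentially. LGH_near e L (Xs n) (\<alpha>s n) X \<alpha>"
proof -
  have "\<forall>\<^sub>F n in sequentially. LGH_dist L (Xs n) (\<alpha>s n) X \<alpha> < ennreal e"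
    using assms(1,4) unfolding LGH_converges_def by (intro order_tendstoD(2)) auto
  then show ?thesis
    by eventually_elim (use assms in \<open>auto intro: LGH_near_if_LGH_dist_less\<close>)
qed

text \<open>Provides a single scale per index, so that a net can later be chosen once for each
  \<open>n\<close>, independently of the tolerance in the limit.\<close>

lemma LGH_converges_imp_near_null_sequence:
  assumes "LGH_converges L Xs \<alpha>s X \<alpha>" "\<And>n. \<alpha>s n \<in> L \<rightarrow> mspace (Xs n)" "\<alpha> \<in> L \<rightarrow> mspace X"
  obtains t where "t \<longlonglongrightarrow> 0" "\<forall>\<^sub>F n in sequentially. LGH_near (t n) L (Xs n) (\<alpha>s n) X \<alpha>"
proof
  let ?D = "\<lambda>n. LGH_dist L (Xs n) (\<alpha>s n) X \<alpha>"
  \<comment> \<open>The distance is an infimum that may not be attained; the positive null term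
    makes room for a strict inequality.\<close>
  let ?t = "\<lambda>n. enn2real (?D n) + 1 / real (Suc n)"
  have D: "?D \<longlonglongrightarrow> 0" using assms(1) unfolding LGH_converges_def .
  have "(\<lambda>n. enn2real (?D n)) \<longlonglongrightarrow> 0"
    using D by (intro tendsto_enn2real) auto
  from tendsto_add[OF this LIMSEQ_Suc[OF lim_1_over_n]]
  show "?t \<longlonglongrightarrow> 0" by simp
  \<comment> \<open>\<open>enn2real\<close> maps infinity to 0, so \<open>?t n\<close> dominates the
    distance only where the latter is finite.\<close>
  have "\<forall>\<^sub>F n in sequentially. ?D n < \<infinity>"
    using D by (rule order_tendstoD(2)) simp
  then show "\<forall>\<^sub>F n in sequentially. LGH_near (?t n) L (Xs n) (\<alpha>s n) X \<alpha>"
  proof eventually_elim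
    case (elim n)
    then have "?D n = ennreal (enn2real (?D n))" by (simp add: less_top)
    also have "\<dots> < ennreal (?t n)" by (intro ennreal_lessI add_nonneg_pos) auto
    finally show ?case using assms(2,3) by (rule LGH_near_if_LGH_dist_less)
  qed
qed

lemma LGH_convergesI:
  assumes "\<And>e. 0 < e \<Longrightarrow> \<forall>\<^sub>F n in sequentially. LGH_near e L (Xs n) (\<alpha>s n) X \<alpha>"
  shows "LGH_converges L Xs \<alpha>s X \<alpha>"
  unfolding LGH_converges_def
proof (rule order_tendstoI)
  fix a :: ennreal
  assume "0 < a"
  \<comment> \<open>Closeness yields only a weak bound and \<open>a\<close> may be infinite; an
    intermediate \<open>b\<close> is finite and restores strictness.\<close>
  then obtain b where b: "0 < b" "b < a" using dense by blast
  have b': "b = ennreal (enn2real b)" using order.strict_trans2[OF b(2) top_greatest] by simp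
  then have "0 < enn2real b" using b(1) by (metis ennreal_0 enn2real_nonneg less_le)
  from assms[OF this]
  show "\<forall>\<^sub>F n in sequentially. LGH_dist L (Xs n) (\<alpha>s n) X \<alpha> < a"
    by eventually_elim (metis LGH_dist_le_if_LGH_near b(2) b' enn2real_nonneg le_less_trans)
qed simp

section \<open>Extending a coupling of subsets to the ambient spaces\<close>

text \<open>The extension takes cheapest paths from \<open>X\<close> to \<open>A\<close>, across the given coupling to \<open>B\<close>, and
  on to \<open>Y\<close>.\<close>

lemma metric_coupling_extend:
  fixes X :: "'a metric" and Y :: "'b metric"
  assumes d: "metric_coupling (submetric X A) (submetric Y B) d"
    and A: "A \<subseteq> mspace X" "A \<noteq> {}" and B: "B \<subseteq> mspace Y" "B \<noteq> {}"
  obtains D where "metric_coupling X Y D"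
    "\<And>a b. a \<in> A \<Longrightarrow> b \<in> B \<Longrightarrow> D (Inl a) (Inr b) \<le> d (Inl a) (Inr b)"
proof -
  have sub: "mspace (submetric X A) = A" "mspace (submetric Y B) = B"
    using A B by auto
  note dD = metric_couplingD[OF d, unfolded sub]
  note dP = pseudometric_onD[OF dD(1)]
  have [simp]: "a \<in> A \<Longrightarrow> a \<in> mspace X" "b \<in> B \<Longrightarrow> b \<in> mspace Y" for a b
    using A B by auto
  define w where "w x y p = mdist X x (fst p) + d (Inl (fst p)) (Inr (snd p)) + mdist Y (snd p) y"
    for x y p
  define c where "c x y = (INF p\<in>A \<times> B. w x y p)" for x y
  \<comment> \<open>The infimum is over reals: the lower bound 0 puts \<open>c\<close> below every
    path length, and nonemptiness of \<open>A\<close> and \<open>B\<close> passes common lower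
    bounds on to \<open>c\<close>.\<close>
  have w0: "0 \<le> w x y p" if "p \<in> A \<times> B" for x y p
    using that dP(2)[of "Inl (fst p)" "Inr (snd p)"] by (auto simp: w_def)
  have c_le: "c x y \<le> w x y p" if "p \<in> A \<times> B" for x y p
    unfolding c_def using that w0 by (intro cINF_lower bdd_belowI2[where m = 0])
  have c_ge: "k \<le> c x y" if "\<And>p. p \<in> A \<times> B \<Longrightarrow> k \<le> w x y p" for x y k
    unfolding c_def using A(2) B(2) that by (intro cINF_greatest) auto
  have c0: "0 \<le> c x y" for x y using w0 by (intro c_ge)
  \<comment> \<open>Moving an endpoint alters only the outer leg of each path; \<open>triY\<close>
    is the same at the other end.\<close>
  have triX: "c x y \<le> mdist X x x' + c x' y" if "x \<in> mspace X" "x' \<in> mspace X" for x x' y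
  proof -
    have "c x y - mdist X x x' \<le> w x' y p" if p: "p \<in> A \<times> B" for p
      using c_le[OF p, of x y] mdist_triangle[of x X x' "fst p"] p
        \<open>x \<in> mspace X\<close> \<open>x' \<in> mspace X\<close> by (auto simp: w_def)
    then show ?thesis using c_ge[of "c x y - mdist X x x'" x' y] by simp
  qed
  have triY: "c x y \<le> c x y' + mdist Y y' y" if "y \<in> mspace Y" "y' \<in> mspace Y" for x y y'
  proof -
    have "c x y - mdist Y y' y \<le> w x y' p" if p: "p \<in> A \<times> B" for p
      using c_le[OF p, of x y] mdist_triangle[of "snd p" Y y' y] p
        \<open>y \<in> mspace Y\<close> \<open>y' \<in> mspace Y\<close> by (auto simp: w_def)
    then show ?thesis using c_ge[of "c x y - mdist Y y' y" x y'] by simp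
  qed
  \<comment> \<open>Two paths meeting at \<open>y\<close> form a route x, a, b, y, b', a', x'. Its
    part through \<open>Y\<close> is at least \<open>mdist Y b b'\<close>, and on the subsets
    \<open>d\<close> agrees with both metrics, so the detour is no shorter than
    \<open>mdist X x x'\<close>. The two infima are then taken one after the other.\<close>
  have triXYX: "mdist X x x' \<le> c x y + c x' y"
    if "x \<in> mspace X" "x' \<in> mspace X" "y \<in> mspace Y" for x x' y
  proof -
    have *: "mdist X x x' \<le> w x y p + w x' y q" if mem: "p \<in> A \<times> B" "q \<in> A \<times> B" for p q
    proof -
      obtain a b a' b' where pq: "p = (a, b)" "q = (a', b')" "a \<in> A" "b \<in> B" "a' \<in> A" "b' \<in> B"
        using mem by auto
      have "mdist X a a' \<le> d (Inl a) (Inr b) + mdist Y b b' + d (Inl a') (Inr b')"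
        using dP(4)[of "Inl a" "Inr b" "Inl a'"] dP(4)[of "Inr b" "Inr b'" "Inl a'"]
          dP(3)[of "Inl a'" "Inr b'"] dD(2)[of a a'] dD(3)[of b b'] pq by auto
      moreover have "mdist Y b b' \<le> mdist Y b y + mdist Y b' y"
        using mdist_triangle[of b Y y b'] mdist_commute[of Y y b'] pq \<open>y \<in> mspace Y\<close> by simp
      moreover have "mdist X x x' \<le> mdist X x a + mdist X a a' + mdist X x' a'"
        using mdist_triangle[of x X a x'] mdist_triangle[of a X a' x'] mdist_commute[of X x' a']
          pq \<open>x \<in> mspace X\<close> \<open>x' \<in> mspace X\<close> by simp
      ultimately show ?thesis by (simp add: w_def pq(1,2))
    qed
    have "mdist X x x' - w x y p \<le> c x' y" if "p \<in> A \<times> B" for p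
      using *[OF that] by (intro c_ge) (simp add: algebra_simps)
    then show ?thesis using c_ge[of "mdist X x x' - c x' y" x y] by (simp add: algebra_simps)
  qed
  have triYXY: "mdist Y y y' \<le> c x y + c x y'"
    if "x \<in> mspace X" "y \<in> mspace Y" "y' \<in> mspace Y" for x y y'
  proof -
    have *: "mdist Y y y' \<le> w x y p + w x y' q" if mem: "p \<in> A \<times> B" "q \<in> A \<times> B" for p q
    proof -
      obtain a b a' b' where pq: "p = (a, b)" "q = (a', b')" "a \<in> A" "b \<in> B" "a' \<in> A" "b' \<in> B"
        using mem by auto
      have "mdist Y b b' \<le> d (Inl a) (Inr b) + mdist X a a' + d (Inl a') (Inr b')"
        using dP(4)[of "Inr b" "Inl a" "Inr b'"] dP(4)[of "Inl a" "Inl a'" "Inr b'"]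
          dP(3)[of "Inl a" "Inr b"] dD(2)[of a a'] dD(3)[of b b'] pq by auto
      moreover have "mdist X a a' \<le> mdist X x a + mdist X x a'"
        using mdist_triangle[of a X x a'] mdist_commute[of X x a] pq \<open>x \<in> mspace X\<close> by simp
      moreover have "mdist Y y y' \<le> mdist Y b y + mdist Y b b' + mdist Y b' y'"
        using mdist_triangle[of y Y b y'] mdist_triangle[of b Y b' y'] mdist_commute[of Y y b]
          pq \<open>y \<in> mspace Y\<close> \<open>y' \<in> mspace Y\<close> by simp
      ultimately show ?thesis by (simp add: w_def pq(1,2))
    qed
    have "mdist Y y y' - w x y p \<le> c x y'" if "p \<in> A \<times> B" for p
      using *[OF that] by (intro c_ge) (simp add: algebra_simps)
    then show ?thesis using c_ge[of "mdist Y y y' - c x y'" x y] by (simp add: algebra_simps)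
  qed
  have triX': "c x y \<le> c x' y + mdist X x' x" if "x \<in> mspace X" "x' \<in> mspace X" for x x' y
    using triX[OF that] by (simp add: mdist_commute add.commute)
  have triY': "c x y \<le> mdist Y y y' + c x y'" if "y \<in> mspace Y" "y' \<in> mspace Y" for x y y'
    using triY[OF that] by (simp add: mdist_commute add.commute)
  define D where "D u v = (case u of
      Inl x \<Rightarrow> (case v of Inl x' \<Rightarrow> mdist X x x' | Inr y \<Rightarrow> c x y)
    | Inr y \<Rightarrow> (case v of Inl x \<Rightarrow> c x y | Inr y' \<Rightarrow> mdist Y y y'))" for u v
  have D_simps [simp]: "D (Inl x) (Inl x') = mdist X x x'" "D (Inl x) (Inr y) = c x y"
    "D (Inr y) (Inl x) = c x y" "D (Inr y) (Inr y') = mdist Y y y'" for x x' y y'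
    by (auto simp: D_def)
  \<comment> \<open>Of the eight distributions of three points over the two sides, two are the
    triangle inequalities of \<open>X\<close> and \<open>Y\<close>; the other six are the facts
    \<open>triX\<close> to \<open>triY'\<close>.\<close>
  have "D u v \<le> D u z + D z v"
    if "u \<in> mspace X <+> mspace Y" "z \<in> mspace X <+> mspace Y" "v \<in> mspace X <+> mspace Y" for u v z
    using that triX triX' triY triY' triXYX triYXY
    by (elim PlusE) (simp_all add: mdist_triangle)
  moreover have "D u u = 0" "0 \<le> D u v" "D u v = D v u"
    if "u \<in> mspace X <+> mspace Y" "v \<in> mspace X <+> mspace Y" for u v
    using that c0 by (auto simp: mdist_commute)
  ultimately have "metric_coupling X Y D"
    unfolding metric_coupling_def pseudometric_on_def by simp
  \<comment> \<open>The path through \<open>(a, b)\<close> itself has outer legs of length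
    0.\<close>
  moreover have "D (Inl a) (Inr b) \<le> d (Inl a) (Inr b)" if "a \<in> A" "b \<in> B" for a b
    using c_le[of "(a, b)" a b] that
    by (simp add: w_def Metric_space.mdist_zero[OF Metric_space_mspace_mdist])
  ultimately show thesis by (rule that)
qed

section \<open>Labeled nets: existence, transport, and comparison of the ambient spaces\<close>

lemma labeled_eps_netD:
  assumes "labeled_eps_net \<epsilon> L X \<alpha> S \<beta>"
  shows "finite S" "\<beta> \<in> L \<rightarrow> S" "S \<subseteq> mspace X"
    and "x \<in> mspace X \<Longrightarrow> \<exists>s\<in>S. mdist X s x < \<epsilon>"
    and "l \<in> L \<Longrightarrow> mdist X (\<alpha> l) (\<beta> l) < \<epsilon>"
proof -
  show "finite S" "\<beta> \<in> L \<rightarrow> S" "S \<subseteq> mspace X" "x \<in> mspace X \<Longrightarrow> \<exists>s\<in>S. mdist X s x < \<epsilon>"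
    using assms unfolding labeled_eps_net_def eps_net_def by blast+
  assume "l \<in> L"
  then have "ennreal (mdist X (\<alpha> l) (\<beta> l)) < ennreal \<epsilon>"
    using assms unfolding labeled_eps_net_def by (meson SUP_upper le_less_trans)
  then show "mdist X (\<alpha> l) (\<beta> l) < \<epsilon>" by (simp add: ennreal_less_iff)
qed

text \<open>For infinite \<open>L\<close>, pointwise bounds below \<epsilon> do not keep the
  supremum below \<epsilon>; the uniform \<delta> does.\<close>

lemma labeled_eps_netI:
  assumes "finite S" "\<beta> \<in> L \<rightarrow> S" "S \<subseteq> mspace X"
    and "\<And>x. x \<in> mspace X \<Longrightarrow> \<exists>s\<in>S. mdist X s x < \<epsilon>"
    and "\<And>l. l \<in> L \<Longrightarrow> mdist X (\<alpha> l) (\<beta> l) \<le> \<delta>" and "0 \<le> \<delta>" "\<delta> < \<epsilon>"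
  shows "labeled_eps_net \<epsilon> L X \<alpha> S \<beta>"
proof -
  have "(SUP l\<in>L. ennreal (mdist X (\<alpha> l) (\<beta> l))) \<le> ennreal \<delta>"
    using assms(5) by (intro SUP_least ennreal_leI)
  also have "\<dots> < ennreal \<epsilon>" using assms(6,7) by (simp add: ennreal_less_iff)
  finally show ?thesis using assms(1-4) unfolding labeled_eps_net_def eps_net_def by blast
qed

text \<open>Compactness gives total boundedness, and each label moves to a nearby net point. The
  radius \<open>\<epsilon>/2\<close> leaves the gap that the strict supremum bound requires.\<close>

lemma labeled_eps_net_exists:
  assumes "labeled_metric_space L X \<alpha>" "0 < \<epsilon>"
  obtains S \<beta> where "labeled_eps_net \<epsilon> L X \<alpha> S \<beta>"
proof -
  interpret Metric_space "mspace X" "mdist X" by (rule Metric_space_mspace_mdist)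
  have "compact_space mtopology"
    using assms(1) unfolding labeled_metric_space_def mtopology_of_def by simp
  then have "mtotally_bounded (mspace X)"
    by (simp add: compact_space_eq_mcomplete_mtotally_bounded)
  then obtain S where S: "finite S" "S \<subseteq> mspace X" "mspace X \<subseteq> (\<Union>x\<in>S. mball x (\<epsilon>/2))"
    using assms(2) unfolding mtotally_bounded_def by (meson half_gt_zero)
  have "\<exists>s\<in>S. mdist X s x < \<epsilon>/2" if "x \<in> mspace X" for x
    using S(3) that by fastforce
  then obtain f where f: "\<And>x. x \<in> mspace X \<Longrightarrow> f x \<in> S \<and> mdist X (f x) x < \<epsilon>/2"
    by metis
  have \<alpha>: "\<alpha> l \<in> mspace X" if "l \<in> L" for l
    using assms(1) that unfolding labeled_metric_space_def by blast
  have "labeled_eps_net \<epsilon> L X \<alpha> S (\<lambda>l. f (\<alpha> l))"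
  proof (rule labeled_eps_netI[where \<delta> = "\<epsilon>/2"])
    show "\<exists>s\<in>S. mdist X s x < \<epsilon>" if "x \<in> mspace X" for x
      using f[OF that] assms(2) by (intro bexI[of _ "f x"]) auto
    show "mdist X (\<alpha> l) (f (\<alpha> l)) \<le> \<epsilon>/2" if "l \<in> L" for l
      using f[OF \<alpha>[OF that]] by (simp add: mdist_commute)
  qed (use S f \<alpha> assms(2) in auto)
  then show thesis by (rule that)
qed

text \<open>Each net point \<open>s\<close> is replaced by a partner \<open>f s\<close> within
  \<open>t\<close> of it. Pairing \<open>s\<close> with \<open>f s\<close> keeps the nets
  \<open>t\<close>-close under the same coupling, while the mesh grows by two crossings.\<close>

lemma LGH_near_transport_net:
  assumes near: "LGH_near t L Y \<alpha>' X \<alpha>" and net: "labeled_eps_net \<delta> L X \<alpha> S \<beta>"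
    and \<alpha>': "\<alpha>' \<in> L \<rightarrow> mspace Y" and \<alpha>: "\<alpha> \<in> L \<rightarrow> mspace X"
    and \<epsilon>: "0 \<le> t" "0 \<le> \<delta>" "2 * t + \<delta> < \<epsilon>"
  obtains S' \<beta>' where "labeled_eps_net \<epsilon> L Y \<alpha>' S' \<beta>'"
    "LGH_near t L (submetric Y S') \<beta>' (submetric X S) \<beta>"
proof -
  obtain d where d: "metric_coupling Y X d"
    "\<And>y. y \<in> mspace Y \<Longrightarrow> \<exists>x\<in>mspace X. d (Inl y) (Inr x) < t"
    "\<And>x. x \<in> mspace X \<Longrightarrow> \<exists>y\<in>mspace Y. d (Inl y) (Inr x) < t"
    "\<And>l. l \<in> L \<Longrightarrow> d (Inl (\<alpha>' l)) (Inr (\<alpha> l)) < t"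
    using near unfolding LGH_near_def by blast
  note dD = metric_couplingD[OF d(1)]
  note dP = pseudometric_onD[OF dD(1)]
  note netD = labeled_eps_netD[OF net]
  obtain f where f: "\<And>x. x \<in> mspace X \<Longrightarrow> f x \<in> mspace Y \<and> d (Inl (f x)) (Inr x) < t"
    using d(3) by metis
  \<comment> \<open>The route f s, s, x, y costs less than \<open>t + \<delta> + t\<close>. It
    serves both the covering of \<open>Y\<close> and, with the points \<alpha>' l, \<alpha> l,
    \<beta> l, the labels.\<close>
  have path: "mdist Y (f s) y < 2 * t + \<delta>"
    if "y \<in> mspace Y" "x \<in> mspace X" "s \<in> S" "d (Inl y) (Inr x) < t" "mdist X s x < \<delta>" for x y s
  proof -
    have s: "s \<in> mspace X" using that(3) netD(3) by blast
    show ?thesis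
      using dP(4)[of "Inl (f s)" "Inr s" "Inl y"] dP(4)[of "Inr s" "Inr x" "Inl y"]
        dP(3)[of "Inr x" "Inl y"] dD(2)[of "f s" y] dD(3)[of s x] f[OF s] s that
      by auto
  qed
  have "labeled_eps_net \<epsilon> L Y \<alpha>' (f ` S) (\<lambda>l. f (\<beta> l))"
  proof (rule labeled_eps_netI[where \<delta> = "2 * t + \<delta>"])
    show "\<exists>s\<in>f ` S. mdist Y s y < \<epsilon>" if "y \<in> mspace Y" for y
      using d(2)[OF that] netD(4) path[OF that] \<epsilon>(3) by (meson imageI less_trans)
    show "mdist Y (\<alpha>' l) (f (\<beta> l)) \<le> 2 * t + \<delta>" if "l \<in> L" for l
      using path[of "\<alpha>' l" "\<alpha> l" "\<beta> l"] d(4)[OF that] netD(2) netD(5)[OF that] \<alpha> \<alpha>' that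
      by (simp add: mdist_commute Pi_iff)
  qed (use netD(1-3) f \<epsilon> in auto)
  moreover have "LGH_near t L (submetric Y (f ` S)) (\<lambda>l. f (\<beta> l)) (submetric X S) \<beta>"
    unfolding LGH_near_def
    by (rule exI[of _ d]) (use metric_coupling_submetric[OF d(1)] f netD(2,3) in \<open>auto, blast\<close>)
  ultimately show thesis by (rule that)
qed

text \<open>A point steps to its net, crosses to the other net and steps off again, each leg costing
  less than \<open>e\<close>.\<close>

lemma LGH_near_from_nets:
  assumes near: "LGH_near e L (submetric X S) \<beta> (submetric Y T) \<gamma>"
    and S: "labeled_eps_net e L X \<alpha> S \<beta>" and T: "labeled_eps_net e L Y \<alpha>' T \<gamma>"
    and \<alpha>: "\<alpha> \<in> L \<rightarrow> mspace X" and \<alpha>': "\<alpha>' \<in> L \<rightarrow> mspace Y"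
  shows "LGH_near (3 * e) L X \<alpha> Y \<alpha>'"
proof -
  note SD = labeled_eps_netD[OF S] and TD = labeled_eps_netD[OF T]
  have sub: "mspace (submetric X S) = S" "mspace (submetric Y T) = T"
    using SD(3) TD(3) by auto
  obtain d where d: "metric_coupling (submetric X S) (submetric Y T) d"
    "\<And>s. s \<in> S \<Longrightarrow> \<exists>t\<in>T. d (Inl s) (Inr t) < e"
    "\<And>t. t \<in> T \<Longrightarrow> \<exists>s\<in>S. d (Inl s) (Inr t) < e"
    "\<And>l. l \<in> L \<Longrightarrow> d (Inl (\<beta> l)) (Inr (\<gamma> l)) < e"
    using near unfolding LGH_near_def sub by blast
  show ?thesis
  \<comment> \<open>Gluing requires nonempty nets. An empty net forces both spaces to be empty, and
    then \<alpha> forces \<open>L\<close> to be empty as well.\<close>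
  proof (cases "S = {}")
    case True
    then have "T = {}" using d(3) by blast
    then have "mspace X = {}" "mspace Y = {}" using True SD(4) TD(4) by blast+
    then show ?thesis
      using \<alpha> unfolding LGH_near_def metric_coupling_def pseudometric_on_def by auto
  next
    case False
    then have "T \<noteq> {}" using d(2) by blast
    then obtain D where D: "metric_coupling X Y D"
      "\<And>s t. s \<in> S \<Longrightarrow> t \<in> T \<Longrightarrow> D (Inl s) (Inr t) \<le> d (Inl s) (Inr t)"
      using metric_coupling_extend[OF d(1) SD(3) False TD(3)] by blast
    note DD = metric_couplingD[OF D(1)]
    note DP = pseudometric_onD[OF DD(1)]
    have path: "D (Inl x) (Inr y) < 3 * e"
      if "x \<in> mspace X" "y \<in> mspace Y" "s \<in> S" "t \<in> T"
        "mdist X s x < e" "d (Inl s) (Inr t) < e" "mdist Y t y < e" for x y s t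
    proof -
      have st: "s \<in> mspace X" "t \<in> mspace Y" using that SD(3) TD(3) by auto
      show ?thesis
        using DP(4)[of "Inl x" "Inl s" "Inr y"] DP(4)[of "Inl s" "Inr t" "Inr y"]
          DD(2)[of x s] DD(3)[of t y] D(2)[of s t] st that mdist_commute[of X x s]
        by auto
    qed
    \<comment> \<open>Having a net point at all forces \<open>e\<close> to be positive; the trivial
      leg from \<open>t\<close> to itself then lets the net point serve as the witness in
      \<open>path\<close>.\<close>
    have T_pos: "mdist Y t t < e" if "t \<in> T" for t
      using TD(3,4) that by (metis le_less_trans mdist_nonneg mdist_zero subsetD)
    have S_pos: "mdist X s s < e" if "s \<in> S" for s
      using SD(3,4) that by (metis le_less_trans mdist_nonneg mdist_zero subsetD)
    show ?thesis
      unfolding LGH_near_def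
    proof (intro exI[of _ D] conjI ballI)
      show "\<exists>y\<in>mspace Y. D (Inl x) (Inr y) < 3 * e" if "x \<in> mspace X" for x
        using SD(4)[OF that] d(2) path[OF that] T_pos TD(3) by (meson subsetD)
      show "\<exists>x\<in>mspace X. D (Inl x) (Inr y) < 3 * e" if "y \<in> mspace Y" for y
        using TD(4)[OF that] d(3) path[OF _ that] S_pos SD(3) by (meson subsetD)
      show "D (Inl (\<alpha> l)) (Inr (\<alpha>' l)) < 3 * e" if "l \<in> L" for l
        using path[of "\<alpha> l" "\<alpha>' l" "\<beta> l" "\<gamma> l"] d(4) SD(2,5) TD(2,5) \<alpha> \<alpha>' that
        by (simp add: mdist_commute Pi_iff)
    qed (fact D(1))
  qed
qed

theorem theorem3p10:
  fixes L :: "'l set"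
    and X :: "'a metric" and \<alpha> :: "'l \<Rightarrow> 'a"
    and Xs :: "nat \<Rightarrow> 'b metric" and \<alpha>s :: "nat \<Rightarrow> 'l \<Rightarrow> 'b"
  assumes "labeled_metric_space L X \<alpha>"
    and "\<And>n. labeled_metric_space L (Xs n) (\<alpha>s n)"
  shows "LGH_converges L Xs \<alpha>s X \<alpha> \<longleftrightarrow>
    (\<forall>\<epsilon>>0. \<exists>S \<beta> Ss \<beta>s.
        labeled_eps_net \<epsilon> L X \<alpha> S \<beta> \<and>
        (\<forall>n. labeled_eps_net \<epsilon> L (Xs n) (\<alpha>s n) (Ss n) (\<beta>s n)) \<and>
        LGH_converges L (\<lambda>n. submetric (Xs n) (Ss n)) \<beta>s (submetric X S) \<beta>)"
    (is "?conv \<longleftrightarrow> ?nets")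
proof
  have \<alpha>: "\<alpha> \<in> L \<rightarrow> mspace X" and \<alpha>s: "\<And>n. \<alpha>s n \<in> L \<rightarrow> mspace (Xs n)"
    using assms unfolding labeled_metric_space_def by blast+
  {
    assume conv: ?conv
    obtain t where t: "t \<longlonglongrightarrow> 0" "\<forall>\<^sub>F n in sequentially. LGH_near (t n) L (Xs n) (\<alpha>s n) X \<alpha>"
      using LGH_converges_imp_near_null_sequence[OF conv \<alpha>s \<alpha>] by blast
    show ?nets
    proof (intro allI impI)
      fix \<epsilon> :: real
      assume \<epsilon>: "0 < \<epsilon>"
      \<comment> \<open>With mesh \<open>\<epsilon>/4\<close> and scale below
        \<open>\<epsilon>/4\<close>, the transported net has mesh bound below \<open>3/4\<close> of
        \<epsilon>.\<close>
      obtain S \<beta> where S: "labeled_eps_net (\<epsilon>/4) L X \<alpha> S \<beta>"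
        using labeled_eps_net_exists[OF assms(1), of "\<epsilon>/4"] \<epsilon> by auto
      let ?near = "\<lambda>n T \<gamma> e. LGH_near e L (submetric (Xs n) T) \<gamma> (submetric X S) \<beta>"
      \<comment> \<open>\<open>t n\<close> is only known to tend to 0 and might be negative, while
        transport asks for a nonnegative scale; hence \<open>max 0\<close>.\<close>
      let ?good = "\<lambda>n. LGH_near (max 0 (t n)) L (Xs n) (\<alpha>s n) X \<alpha> \<and> max 0 (t n) < \<epsilon>/4"
      have "\<exists>T \<gamma>. labeled_eps_net \<epsilon> L (Xs n) (\<alpha>s n) T \<gamma> \<and> (?good n \<longrightarrow> ?near n T \<gamma> (max 0 (t n)))"
        for n
      proof (cases "?good n")
        case True
        then obtain T \<gamma> where "labeled_eps_net \<epsilon> L (Xs n) (\<alpha>s n) T \<gamma>" "?near n T \<gamma> (max 0 (t n))"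
          using LGH_near_transport_net[OF _ S \<alpha>s \<alpha>, of "max 0 (t n)" n \<epsilon>] \<epsilon> by auto
        then show ?thesis by blast
      next
        \<comment> \<open>Only finitely many indices are bad, so an arbitrary net there leaves the
          limit unaffected.\<close>
        case False
        then show ?thesis using labeled_eps_net_exists[OF assms(2) \<epsilon>] by metis
      qed
      then obtain Ss \<beta>s where Ss: "\<And>n. labeled_eps_net \<epsilon> L (Xs n) (\<alpha>s n) (Ss n) (\<beta>s n)"
        "\<And>n. ?good n \<Longrightarrow> ?near n (Ss n) (\<beta>s n) (max 0 (t n))"
        by metis
      have "LGH_converges L (\<lambda>n. submetric (Xs n) (Ss n)) \<beta>s (submetric X S) \<beta>"
      proof (rule LGH_convergesI)
        fix e :: real
        assume "0 < e"
        then have "\<forall>\<^sub>F n in sequentially. t n < min e (\<epsilon>/4)"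
          using t(1) \<epsilon> by (intro order_tendstoD(2)) auto
        with t(2) show "\<forall>\<^sub>F n in sequentially. ?near n (Ss n) (\<beta>s n) e"
        proof eventually_elim
          case (elim n)
          then have "?good n" using \<epsilon> by (auto intro: LGH_near_mono)
          then show ?case using Ss(2) elim(2) \<open>0 < e\<close> by (intro LGH_near_mono[OF Ss(2)]) auto
        qed
      qed
      moreover have "labeled_eps_net \<epsilon> L X \<alpha> S \<beta>"
        using labeled_eps_netD[OF S] \<epsilon>
        by (intro labeled_eps_netI[where \<delta> = "\<epsilon>/4"]) (force intro: less_imp_le)+
      ultimately show "\<exists>S \<beta> Ss \<beta>s. labeled_eps_net \<epsilon> L X \<alpha> S \<beta> \<and>
        (\<forall>n. labeled_eps_net \<epsilon> L (Xs n) (\<alpha>s n) (Ss n) (\<beta>s n)) \<and>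
        LGH_converges L (\<lambda>n. submetric (Xs n) (Ss n)) \<beta>s (submetric X S) \<beta>"
        using Ss(1) by blast
    qed
  next
    assume nets: ?nets
    show ?conv
    proof (rule LGH_convergesI)
      fix e :: real
      assume "0 < e"
      \<comment> \<open>One third for each leg of the route through the nets.\<close>
      then have e: "0 < e/3" by simp
      then obtain S \<beta> Ss \<beta>s where S: "labeled_eps_net (e/3) L X \<alpha> S \<beta>"
        and Ss: "\<And>n. labeled_eps_net (e/3) L (Xs n) (\<alpha>s n) (Ss n) (\<beta>s n)"
        and conv: "LGH_converges L (\<lambda>n. submetric (Xs n) (Ss n)) \<beta>s (submetric X S) \<beta>"
        using nets by blast
      have "\<forall>\<^sub>F n in sequentially.
          LGH_near (e/3) L (submetric (Xs n) (Ss n)) (\<beta>s n) (submetric X S) \<beta>"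
      proof (rule LGH_converges_imp_near[OF conv _ _ e])
        show "\<beta>s n \<in> L \<rightarrow> mspace (submetric (Xs n) (Ss n))" for n
          using labeled_eps_netD(2,3)[OF Ss[of n]] by auto
        show "\<beta> \<in> L \<rightarrow> mspace (submetric X S)"
          using labeled_eps_netD(2,3)[OF S] by auto
      qed
      then show "\<forall>\<^sub>F n in sequentially. LGH_near e L (Xs n) (\<alpha>s n) X \<alpha>"
      proof eventually_elim
        case (elim n)
        from LGH_near_from_nets[OF elim Ss S \<alpha>s \<alpha>] show ?case by simp
      qed
    qed
  }
qed

end
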